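(* Let $G=(V,E,\omega)\in\mathbb{G}_\pi$ where $V$ contains at least two vertices. If $v\in V$ is such that both $\mathcal{A}(v,G)=\emptyset$ and $C(v,G)=\mathcal{S}(v,G)$, then $\mathcal{BW}_B(\mathcal{R}_{V\setminus v}(G))\subseteq\mathcal{BW}_B(G)$.
   Context: Let $\mathbb{W}$ be the field of rational functions $p/q$ with $p,q\in\mathbb{C}[\lambda]$, $q\neq 0$, always written in lowest terms (zero is written $0/1$). $\mathbb{G}$ is the set of finite weighted digraphs $G=(V,E,\omega)$, loops allowed, no parallel edges, with $\omega:E\to\mathbb{W}$ and the convention $\omega(e)=0$ iff $e\notin E$; $\mathbb{G}^n$ is the set of those with $n$ vertices. Write $V=\{v_1,\dots,v_n\}$, $e_{ij}=(v_i,v_j)$, and let $M(G)\in\mathbb{W}^{n\times n}$, $M(G)_{ij}=\omega(e_{ij})$, be the weighted adjacency matrix. $\mathbb{G}_\pi^n\subset\mathbb{G}^n$ is the set of graphs all of whose weights are of the form $p/q$ with $\deg(p)\leq\deg(q)$ (the zero weight is allowed), and $\mathbb{G}_\pi=\bigcup_{n\ge1}\mathbb{G}_\pi^n$. Polynomial extension: for $G\in\mathbb{G}^n$ with $M(G)_{ij}=p_{ij}/q_{ij}$ let $L_i(G)=\prod_{j=1}^n q_{ij}$. The graph $\bar G$ has adjacency matrix $M(\bar G)_{ij}=L_i(G)M(G)_{ij}$ for $i\ne j$ and $M(\bar G)_{ii}=L_i(G)(M(G)_{ii}-\lambda)+\lambda$; its entries are polynomials in $\lambda$, so it may be evaluated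 at any $\lambda\in\mathbb{C}$. Cycles: a cycle of $G$ is written as the ordered set $\{u_1,\dots,u_m\}$ (up to cyclic permutation) of its distinct vertices, where $(u_k,u_{k+1})\in E$ for $1\le k<m$ and $(u_m,u_1)\in E$. A strong cycle is a cycle with $m\ge2$. If no strong cycle passes through $v_i$, then $\{v_i\}$ is a weak cycle, whether or not $e_{ii}\in E$. $C_s(G)$ and $C_w(G)$ are the sets of strong and weak cycles, and $C(G)=C_s(G)\cup C_w(G)$. The strongly connected components of $G$ are its maximal strongly connected subgraphs (possibly a single vertex). Brualdi-type region: let $\tilde r_i(\bar G)=\sum_{j}|M(\bar G)_{ij}|$, the sum over those $j\ne i$ such that $v_j$ lies in the same strongly connected component of $\bar G$ as $v_i$ (a function of $\lambda\in\mathbb{C}$). Then $\mathcal{BW}_B(G)=\bigcup_{\gamma\in C(\bar G)}\{\lambda\in\mathbb{C}:\prod_{v_i\in\gamma}|\lambda-M(\bar G)_{ii}|\le\prod_{v_i\in\gamma}\tilde r_i(\bar G)\}$. $E^{scc}\subseteq E$ is the set of edges of $G$ belonging to some strongly connected component of $G$. A cycle $\gamma\in C(G)$ is adjacent to $v_i$ if $v_i\notin\gamma$ and there is $v_j\in\gamma$ with $e_{ji}\in E^{scc}$; $\mathcal{A}(v_i,G)$ is the set of $\gamma\in C(G)$ adjacent to $v_i$. $C(v_i,G)=\{\gamma\in C(G):v_i\in\gamma\}$. $\mathcal{S}(v_i,G)\subseteq C(v_i,G)$ is the set of cycles $\gamma=\{u_1,\dots,u_m\}\in C(v_i,G)$,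 written with $u_1=v_i$, such that either $m=1$, or $m>1$ and: $(u_j,u_1)\notin E$ for all $1<j<m$, and $(u_m,w)\notin E^{scc}$ for every vertex $w\notin\{u_1,\dots,u_m\}$. Reduction: for $G\in\mathbb{G}_\pi$ with at least two vertices and $v=v_k\in V$, $\mathcal{R}_{V\setminus v}(G)$ is the graph with vertex set $V\setminus\{v\}$ in which the edge $(v_i,v_j)$ has weight $\omega(e_{ij})+\frac{\omega(e_{ik})\omega(e_{kj})}{\lambda-\omega(e_{kk})}$ (no edge if this is $0$). *)

theory Defs
  imports
    "HOL-Computational_Algebra.Computational_Algebra"
    "HOL-Computational_Algebra.Field_as_Ring"
    "Graph_Theory.Digraph_Component"
begin

section \<open>Rational functions over the complex numbers\<close>

type_synonym ratfun = "complex poly fract"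

text \<open>
  \<open>quot_of_fract\<close> yields the representation in lowest terms, with monic denominator;
  in particular zero is represented as \<open>0/1\<close>.
\<close>

definition numer :: "ratfun \<Rightarrow> complex poly" where
  "numer w = fst (quot_of_fract w)"

definition denom :: "ratfun \<Rightarrow> complex poly" where
  "denom w = snd (quot_of_fract w)"

definition Lam :: ratfun where
  "Lam = to_fract [:0, 1:]"

text \<open>
  The value at a point; it is only used below for weights that are polynomials, that is, have
  denominator 1 (lemma \<open>denom_poly_ext\<close>).
\<close>

definition ev :: "ratfun \<Rightarrow> complex \<Rightarrow> complex" where
  "ev w z = poly (numer w) z / poly (denom w) z"


section \<open>Weighted digraphs\<close>

text \<open>
  Because of the convention that an edge is present if and only if its weight is nonzero, a
  weighted digraph consists of its vertices and its weights; \<open>weight G i j\<close> is also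
  the \<open>(i, j)\<close> entry of the weighted adjacency matrix.
\<close>

record 'a wdigraph =
  vertices :: "'a set"
  weight :: "'a \<Rightarrow> 'a \<Rightarrow> ratfun"

definition edges :: "'a wdigraph \<Rightarrow> ('a \<times> 'a) set" where
  "edges G = {(i, j). weight G i j \<noteq> 0}"

definition graphs :: "'a wdigraph set" where
  "graphs = {G. finite (vertices G) \<and> vertices G \<noteq> {} \<and>
                edges G \<subseteq> vertices G \<times> vertices G}"

definition graphs_pi :: "'a wdigraph set" where
  "graphs_pi = {G \<in> graphs. \<forall>i\<in>vertices G. \<forall>j\<in>vertices G.
                  degree (numer (weight G i j)) \<le> degree (denom (weight G i j))}"

definition digraph_of :: "'a wdigraph \<Rightarrow> ('a, 'a \<times> 'a) pre_digraph" where
  "digraph_of G = \<lparr>verts = vertices G, arcs = edges G, tail = fst, head = snd\<rparr>"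

definition same_scc :: "'a wdigraph \<Rightarrow> 'a \<Rightarrow> 'a \<Rightarrow> bool" where
  "same_scc G i j \<longleftrightarrow> (\<exists>H\<in>pre_digraph.sccs (digraph_of G). i \<in> verts H \<and> j \<in> verts H)"

definition edges_scc :: "'a wdigraph \<Rightarrow> ('a \<times> 'a) set" where
  "edges_scc G = (\<Union>H\<in>pre_digraph.sccs (digraph_of G). arcs H)"


section \<open>Cycles\<close>

text \<open>
  A cycle is an equivalence class of vertex lists up to rotation.
\<close>

type_synonym 'a cyc = "'a list set"

definition cyc_of :: "'a list \<Rightarrow> 'a cyc" where
  "cyc_of us = {rotate k us | k. True}"

definition cyc_verts :: "'a cyc \<Rightarrow> 'a set" where
  "cyc_verts \<gamma> = (\<Union>us\<in>\<gamma>. set us)"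

definition strong_cycles :: "'a wdigraph \<Rightarrow> 'a cyc set" where
  "strong_cycles G = {cyc_of us | us.
     distinct us \<and> 2 \<le> length us \<and> set us \<subseteq> vertices G \<and>
     (\<forall>k. Suc k < length us \<longrightarrow> (us ! k, us ! Suc k) \<in> edges G) \<and>
     (last us, hd us) \<in> edges G}"

definition weak_cycles :: "'a wdigraph \<Rightarrow> 'a cyc set" where
  "weak_cycles G = {cyc_of [i] | i.
     i \<in> vertices G \<and> (\<forall>\<gamma>\<in>strong_cycles G. i \<notin> cyc_verts \<gamma>)}"

definition cycles :: "'a wdigraph \<Rightarrow> 'a cyc set" where
  "cycles G = strong_cycles G \<union> weak_cycles G"

definition cycles_adjacent :: "'a \<Rightarrow> 'a wdigraph \<Rightarrow> 'a cyc set" where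
  "cycles_adjacent i G =
     {\<gamma> \<in> cycles G. i \<notin> cyc_verts \<gamma> \<and> (\<exists>j\<in>cyc_verts \<gamma>. (j, i) \<in> edges_scc G)}"

definition cycles_through :: "'a \<Rightarrow> 'a wdigraph \<Rightarrow> 'a cyc set" where
  "cycles_through i G = {\<gamma> \<in> cycles G. i \<in> cyc_verts \<gamma>}"

text \<open>
  List positions start at 0, so the conditions \<open>0 < j\<close> and \<open>Suc j < length us\<close> describe the
  vertices strictly between the first and the last one.
\<close>

definition cycles_S :: "'a \<Rightarrow> 'a wdigraph \<Rightarrow> 'a cyc set" where
  "cycles_S i G = {\<gamma> \<in> cycles_through i G. \<exists>us\<in>\<gamma>. hd us = i \<and>
     (length us = 1 \<or>
      length us > 1 \<and>
      (\<forall>j. 0 < j \<and> Suc j < length us \<longrightarrow> (us ! j, hd us) \<notin> edges G) \<and>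
      (\<forall>w\<in>vertices G. w \<notin> set us \<longrightarrow> (last us, w) \<notin> edges_scc G))}"


section \<open>Polynomial extension, Brualdi-type region and vertex reduction\<close>

definition rowden :: "'a wdigraph \<Rightarrow> 'a \<Rightarrow> complex poly" where
  "rowden G i = (\<Prod>j\<in>vertices G. denom (weight G i j))"

definition poly_ext :: "'a wdigraph \<Rightarrow> 'a wdigraph" where
  "poly_ext G = \<lparr>vertices = vertices G,
     weight = (\<lambda>i j.
       if i \<in> vertices G \<and> j \<in> vertices G then
         if i = j then to_fract (rowden G i) * (weight G i i - Lam) + Lam
         else to_fract (rowden G i) * weight G i j
       else 0)\<rparr>"

definition r_tilde :: "'a wdigraph \<Rightarrow> 'a \<Rightarrow> complex \<Rightarrow> real" where
  "r_tilde H i z = (\<Sum>j\<in>{j \<in> vertices H. j \<noteq> i \<and> same_scc H i j}. cmod (ev (weight H i j) z))"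

definition BW_B :: "'a wdigraph \<Rightarrow> complex set" where
  "BW_B G = (\<Union>\<gamma>\<in>cycles (poly_ext G).
     {z. (\<Prod>i\<in>cyc_verts \<gamma>. cmod (z - ev (weight (poly_ext G) i i) z))
         \<le> (\<Prod>i\<in>cyc_verts \<gamma>. r_tilde (poly_ext G) i z)})"

text \<open>
  For \<open>G \<in> graphs_pi\<close> the denominator \<open>Lam - weight G v v\<close> is nonzero.
\<close>

definition remove_vertex :: "'a wdigraph \<Rightarrow> 'a \<Rightarrow> 'a wdigraph" where
  "remove_vertex G v = \<lparr>vertices = vertices G - {v},
     weight = (\<lambda>i j.
       if i \<in> vertices G - {v} \<and> j \<in> vertices G - {v} then
         weight G i j + weight G i v * weight G v j / (Lam - weight G v v)
       else 0)\<rparr>"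


section \<open>The polynomial extension has polynomial weights\<close>

lemma denom_nonzero: "denom w \<noteq> 0"
  by (simp add: denom_def snd_quot_of_fract_nonzero)

lemma denom_times: "to_fract (denom w) * w = to_fract (numer w)"
proof -
  have "w = to_fract (numer w) / to_fract (denom w)"
    unfolding numer_def denom_def by (metis Fract_conv_to_fract quot_to_fract_def
      quot_to_fract_quot_of_fract case_prod_unfold)
  then show ?thesis
    using denom_nonzero[of w] by (metis nonzero_mult_div_cancel_left times_divide_eq_right to_fract_eq_0_iff)
qed

lemma rowden_times:
  assumes "finite (vertices G)" "j \<in> vertices G"
  shows "\<exists>p. to_fract (rowden G i) * weight G i j = to_fract p"
proof -
  have "rowden G i = denom (weight G i j) * (\<Prod>k\<in>vertices G - {j}. denom (weight G i k))" (is "_ = _ * ?P")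
    unfolding rowden_def using assms by (simp add: prod.remove)
  then have "to_fract (rowden G i) * weight G i j = to_fract (denom (weight G i j)) * weight G i j * to_fract ?P"
    by simp
  also have "\<dots> = to_fract (numer (weight G i j) * ?P)"
    by (simp add: denom_times)
  finally show ?thesis by blast
qed

lemma denom_poly_ext:
  assumes "G \<in> graphs"
  shows "denom (weight (poly_ext G) i j) = 1"
proof -
  have fin: "finite (vertices G)" using assms by (simp add: graphs_def)
  have "\<exists>p. weight (poly_ext G) i j = to_fract p"
  proof (cases "i \<in> vertices G \<and> j \<in> vertices G")
    case True
    then obtain p where p: "to_fract (rowden G i) * weight G i j = to_fract p"
      using rowden_times[OF fin] by blast
    show ?thesis
    proof (cases "i = j")
      case eq: True
      have "weight (poly_ext G) i j = to_fract (p - rowden G i * [:0, 1:] + [:0, 1:])"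
        using True eq p
        by (simp add: poly_ext_def Lam_def right_diff_distrib del: mult_pCons_right flip: to_fract_mult)
      then show ?thesis by blast
    qed (use True p in \<open>auto simp: poly_ext_def\<close>)
  next
    case False
    then have "weight (poly_ext G) i j = to_fract 0" by (auto simp: poly_ext_def)
    then show ?thesis by blast
  qed
  then show ?thesis by (auto simp: denom_def)
qed

lemma Lam_minus_weight_nonzero:
  assumes "G \<in> graphs_pi" "v \<in> vertices G"
  shows "Lam - weight G v v \<noteq> 0"
proof
  assume "Lam - weight G v v = 0"
  then have "weight G v v = Lam" by simp
  then have "numer (weight G v v) = [:0, 1:]" "denom (weight G v v) = 1"
    by (simp_all add: numer_def denom_def Lam_def)
  with assms show False by (fastforce simp: graphs_pi_def)
qed

end

(*
  Suppose z is not in the region of G. Every vertex lies on a cycle, so no diagonal factor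
  z - M_ii (scaled by L_i) vanishes, and one may pass to the normalised entries
  x_ij = M_ij / (z - M_ii). In these terms every cycle of G satisfies prod rho_i < 1 with
  rho_i the sum of |x_ij| over the component of i, while the reduction replaces x_ij by
  x_ij + x_iv x_vj and the diagonal 1 by 1 - x_iv x_vi, up to a nonzero factor per row: no
  pole at z is gained or lost, so L_i changes by a factor that is regular and nonzero at z.

  The two hypotheses on v force a predecessor i of v in the component of v to have no other
  successor there. So every edge of the reduced component that starts at such an i comes from
  a path through v, and a reduced cycle splits at these vertices into cycles of G through v.
  For one piece, with i its predecessor of v, a = rho_i rho_v, b = |x_iv x_vi| and P the
  product of the other rho_j, the cycle gives P a < 1 and the 2-cycle {i, v} gives a < 1 if
  b > 0; hence P (a - b) < 1 - b, which is the strict inequality for the reduced piece.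
*)

theory Submission
  imports Defs
begin

section \<open>Cycles as lists\<close>

text \<open>The star makes each vertex mutual with itself, so a single vertex without a loop is
  still a component.\<close>

definition mutual :: "('a \<times> 'a) set \<Rightarrow> 'a \<Rightarrow> 'a \<Rightarrow> bool" where
  "mutual E i j \<longleftrightarrow> (i, j) \<in> E\<^sup>* \<and> (j, i) \<in> E\<^sup>*"

definition cycle_list :: "('a \<times> 'a) set \<Rightarrow> 'a list \<Rightarrow> bool" where
  "cycle_list E us \<longleftrightarrow> distinct us \<and> 2 \<le> length us \<and>
     successively (\<lambda>i j. (i, j) \<in> E) us \<and> (last us, hd us) \<in> E"

lemma cycle_list_swap:
  assumes "cycle_list E (xs @ ys)"
  shows "cycle_list E (ys @ xs)"
  using assms unfolding cycle_list_def
  by (cases "xs = []"; cases "ys = []") (auto simp: successively_append_iff)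

lemma successively_rtrancl_hd:
  assumes "successively (\<lambda>i j. (i, j) \<in> E) us" "i \<in> set us"
  shows "(hd us, i) \<in> E\<^sup>*"
  using assms
proof (induction us)
  case (Cons a us)
  then show ?case
    by (auto simp: successively_Cons intro: converse_rtrancl_into_rtrancl)
qed simp

lemma successively_rtrancl_last:
  assumes "successively (\<lambda>i j. (i, j) \<in> E) us" "i \<in> set us"
  shows "(i, last us) \<in> E\<^sup>*"
  using assms
proof (induction us)
  case (Cons a us)
  show ?case
  proof (cases "us = []")
    case False
    then have "(hd us, last us) \<in> E\<^sup>*"
      using Cons.prems False by (intro successively_rtrancl_hd) (auto simp: successively_Cons)
    then show ?thesis
      using Cons False by (auto simp: successively_Cons intro: converse_rtrancl_into_rtrancl)
  qed (use Cons in auto)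
qed simp

lemma cycle_list_rtrancl:
  assumes "cycle_list E us" "i \<in> set us" "j \<in> set us"
  shows "(i, j) \<in> E\<^sup>*"
proof -
  have "(i, last us) \<in> E\<^sup>*" "(last us, hd us) \<in> E" "(hd us, j) \<in> E\<^sup>*"
    using assms by (auto simp: cycle_list_def intro: successively_rtrancl_hd successively_rtrancl_last)
  then show ?thesis by (meson rtrancl.rtrancl_into_rtrancl rtrancl_trans)
qed

text \<open>The path grows backwards from \<open>j\<close>; when the new start already lies on it,
  everything before that occurrence is dropped.\<close>

lemma rtrancl_distinct_list:
  assumes "(i, j) \<in> E\<^sup>*"
  obtains us where "us \<noteq> []" "distinct us" "successively (\<lambda>i j. (i, j) \<in> E) us"
    "hd us = i" "last us = j"
  using assms
proof (induction arbitrary: thesis rule: converse_rtrancl_induct)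
  case base
  show ?case by (rule base[of "[j]"]) auto
next
  case (step y z)
  obtain us where us: "us \<noteq> []" "distinct us" "successively (\<lambda>i j. (i, j) \<in> E) us"
    "hd us = z" "last us = j"
    using step.IH by blast
  show ?case
  proof (cases "y \<in> set us")
    case True
    then obtain xs ys where "us = xs @ y # ys" by (meson split_list)
    then show ?thesis
      using us by (intro step.prems[of "y # ys"]) (auto simp: successively_append_iff)
  next
    case False
    then show ?thesis
      using us step.hyps by (intro step.prems[of "y # us"]) (auto simp: successively_Cons)
  qed
qed

lemma edge_cycle_list:
  assumes "(i, j) \<in> E" "(j, i) \<in> E\<^sup>*" "i \<noteq> j"
  obtains us where "cycle_list E us" "hd us = j" "last us = i" "i \<in> set us"
proof -
  obtain us where us: "us \<noteq> []" "distinct us" "successively (\<lambda>i j. (i, j) \<in> E) us"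
    "hd us = j" "last us = i"
    using rtrancl_distinct_list[OF assms(2)] by blast
  have "2 \<le> length us"
    using us assms(3) by (cases us rule: remdups_adj.cases) auto
  with us assms(1) show thesis
    by (intro that[of us]) (auto simp: cycle_list_def)
qed

lemma mutual_cycle_list:
  assumes "mutual E i j" "i \<noteq> j"
  obtains us where "cycle_list E us" "i \<in> set us"
proof -
  obtain k where "(i, k) \<in> E" "(k, j) \<in> E\<^sup>*" "k \<noteq> i"
  proof -
    \<comment> \<open>Without loops the first step of the walk really leaves
      \<open>i\<close>.\<close>
    have "(i, j) \<in> (E - Id)\<^sup>*"
      using assms by (simp add: mutual_def rtrancl_r_diff_Id)
    then obtain k where "(i, k) \<in> E - Id" "(k, j) \<in> (E - Id)\<^sup>*"
      using assms(2) by (meson converse_rtranclE)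
    then show thesis by (intro that[of k]) (auto simp: rtrancl_r_diff_Id)
  qed
  then have "(i, k) \<in> E" "(k, i) \<in> E\<^sup>*" "i \<noteq> k"
    using assms by (auto simp: mutual_def)
  then show thesis
    using that by (meson edge_cycle_list)
qed

text \<open>For 0 < b < a, P a < 1 and a < 1 give a P (a - b) < a - b <= a (1 - b), and a cancels.
  At b = 0, where a may vanish, the claim is P a < 1; at a = b it is b < 1.\<close>

lemma segment_bound:
  fixes P a b :: real
  assumes "0 \<le> b" "b \<le> a" "P * a < 1" "b \<noteq> 0 \<Longrightarrow> a < 1"
  shows "P * (a - b) < 1 - b"
proof (cases "b = 0")
  case False
  with assms have "0 < a" "a < 1" by auto
  have "a * (P * (a - b)) = (P * a) * (a - b)" by (simp add: algebra_simps)
  show ?thesis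
  proof (cases "a = b")
    case False
    then have "(P * a) * (a - b) < 1 * (a - b)"
      using assms by (intro mult_strict_right_mono) auto
    also have "\<dots> \<le> a - a * b"
      using mult_right_mono[of a 1 b] assms \<open>a < 1\<close> by simp
    finally have "a * (P * (a - b)) < a * (1 - b)" by (simp add: algebra_simps)
    then show ?thesis using \<open>0 < a\<close> by simp
  qed (use \<open>a < 1\<close> in simp)
qed (use assms in simp)

section \<open>Reduction of normalised weights\<close>

text \<open>The situation at a fixed point z. \<open>x_E\<close> and \<open>F_E\<close> are one-way:
  a nonzero weight may vanish at z, and a reduced weight may cancel to 0.\<close>

locale vertex_reduction =
  fixes V :: "'a set" and E F :: "('a \<times> 'a) set" and v :: 'a and x :: "'a \<Rightarrow> 'a \<Rightarrow> complex"
  assumes finite_V: "finite V" and v_in: "v \<in> V"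
    and F_sub: "F \<subseteq> (V - {v}) \<times> (V - {v})"
    and F_E: "(i, j) \<in> F \<Longrightarrow> (i, j) \<in> E \<or> (i, v) \<in> E \<and> (v, j) \<in> E"
    and x_E: "i \<in> V \<Longrightarrow> j \<in> V \<Longrightarrow> i \<noteq> j \<Longrightarrow> x i j \<noteq> 0 \<Longrightarrow> (i, j) \<in> E"
    and only_to_v: "(i, v) \<in> E \<Longrightarrow> (v, i) \<in> E\<^sup>* \<Longrightarrow> i \<noteq> v \<Longrightarrow>
      (i, j) \<in> E \<Longrightarrow> (j, i) \<in> E\<^sup>* \<Longrightarrow> i \<noteq> j \<Longrightarrow> j = v"
    and cycle_less_1: "cycle_list E us \<Longrightarrow>
      (\<Prod>i\<in>set us. \<Sum>j\<in>{j \<in> V. j \<noteq> i \<and> mutual E i j}. cmod (x i j)) < 1"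
begin

definition \<rho> :: "'a \<Rightarrow> real" where
  "\<rho> i = (\<Sum>j\<in>{j \<in> V. j \<noteq> i \<and> mutual E i j}. cmod (x i j))"

text \<open>This and \<open>diag'\<close> describe the reduced row up to one factor per row, which
  cancels in the cycle inequalities.\<close>

definition \<rho>' :: "'a \<Rightarrow> real" where
  "\<rho>' i = (\<Sum>j\<in>{j \<in> V - {v}. j \<noteq> i \<and> mutual F i j}. cmod (x i j + x i v * x v j))"

definition diag' :: "'a \<Rightarrow> real" where
  "diag' i = cmod (1 - x i v * x v i)"

text \<open>The predecessors of \<open>v\<close> in its own component, where reduced cycles are
  cut.\<close>

definition returns :: "'a \<Rightarrow> bool" where
  "returns i \<longleftrightarrow> (i, v) \<in> E \<and> (v, i) \<in> E\<^sup>*"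

section \<open>Comparison of reduced and original rows\<close>

lemma rho_nonneg: "0 \<le> \<rho> i"
  by (simp add: \<rho>_def sum_nonneg)

lemma rho'_nonneg: "0 \<le> \<rho>' i"
  by (simp add: \<rho>'_def sum_nonneg)

lemma prod_rho_less_1: "cycle_list E us \<Longrightarrow> (\<Prod>i\<in>set us. \<rho> i) < 1"
  using cycle_less_1 by (simp add: \<rho>_def)

lemma F_rtrancl:
  assumes "(i, j) \<in> F\<^sup>*"
  shows "(i, j) \<in> E\<^sup>*"
  using assms
proof induction
  case (step j k)
  have "(j, k) \<in> E\<^sup>*" using F_E[OF step.hyps(2)] by (meson r_into_rtrancl rtrancl_trans)
  then show ?case using step.IH by auto
qed simp

lemma F_mutual: "mutual F i j \<Longrightarrow> mutual E i j"
  by (simp add: mutual_def F_rtrancl)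

text \<open>A nonzero product gives steps from \<open>i\<close> to \<open>v\<close> and on to
  \<open>j\<close>, which leads back to \<open>i\<close>; then \<open>i\<close> returns.\<close>

lemma not_returns_vanish:
  assumes "\<not> returns i" "i \<in> V - {v}" "j \<in> V - {v}" "(j, i) \<in> E\<^sup>*"
  shows "x i v * x v j = 0"
proof (rule ccontr)
  assume "x i v * x v j \<noteq> 0"
  then have "(i, v) \<in> E" "(v, j) \<in> E"
    using x_E[of i v] x_E[of v j] assms v_in by auto
  with assms(4) have "returns i" by (auto simp: returns_def)
  with assms(1) show False by simp
qed

lemma not_returns_diag':
  assumes "\<not> returns i" "i \<in> V - {v}"
  shows "diag' i = 1"
  using not_returns_vanish[OF assms assms(2)] by (auto simp: diag'_def)

lemma not_returns_rho':
  assumes "\<not> returns i" "i \<in> V - {v}"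
  shows "\<rho>' i \<le> \<rho> i"
proof -
  have "\<rho>' i = (\<Sum>j\<in>{j \<in> V - {v}. j \<noteq> i \<and> mutual F i j}. cmod (x i j))"
    unfolding \<rho>'_def
  proof (intro sum.cong refl)
    fix j assume "j \<in> {j \<in> V - {v}. j \<noteq> i \<and> mutual F i j}"
    then have "x i v * x v j = 0"
      using assms F_mutual[of i j] by (intro not_returns_vanish) (auto simp: mutual_def)
    then show "cmod (x i j + x i v * x v j) = cmod (x i j)" by auto
  qed
  \<comment> \<open>Components only shrink under reduction, and \<open>v\<close> leaves the
    sum.\<close>
  also have "\<dots> \<le> \<rho> i"
    unfolding \<rho>_def using finite_V F_mutual by (intro sum_mono2) auto
  finally show ?thesis .
qed

lemma not_returns_edge:
  assumes "\<not> returns i" "(i, j) \<in> F" "(j, i) \<in> E\<^sup>*"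
  shows "(i, j) \<in> E"
  using F_E[OF assms(2)] assms(1,3) by (auto simp: returns_def intro: converse_rtrancl_into_rtrancl)

text \<open>\<open>only_to_v\<close> forbids a direct edge, as \<open>j\<close> is not
  \<open>v\<close>; so the edge of \<open>F\<close> comes from a detour through
  \<open>v\<close>.\<close>

lemma returns_edge:
  assumes "returns i" "(i, j) \<in> F" "(j, i) \<in> E\<^sup>*" "i \<noteq> j"
  shows "(v, j) \<in> E"
  using F_E[OF assms(2)] only_to_v[of i j] assms F_sub by (auto simp: returns_def)

lemma mutual_v: "returns i \<Longrightarrow> mutual E i v"
  by (auto simp: returns_def mutual_def)

text \<open>By \<open>only_to_v\<close> no direct weight is left in the reduced row, so it is |x_iv|
  times a part of row \<open>v\<close>. The term j = i is missing from that part, which yields the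
  subtracted |x_iv x_vi|.\<close>

lemma returns_rho':
  assumes "returns i" "i \<in> V - {v}"
  shows "\<rho>' i \<le> \<rho> i * \<rho> v - cmod (x i v * x v i)"
    and "cmod (x i v * x v i) \<le> \<rho> i * \<rho> v"
proof -
  let ?S = "{j \<in> V - {v}. j \<noteq> i \<and> mutual F i j}"
  have fin: "finite ?S" using finite_V by simp
  have "cmod (x i j + x i v * x v j) = cmod (x i v) * cmod (x v j)" if "j \<in> ?S" for j
  proof -
    have "(i, j) \<notin> E"
      using only_to_v[of i j] assms that F_mutual[of i j] by (auto simp: returns_def mutual_def)
    then have "x i j = 0" using x_E[of i j] that assms by auto
    then show ?thesis by (simp add: norm_mult)
  qed
  then have "\<rho>' i + cmod (x i v * x v i) = cmod (x i v) * (\<Sum>j\<in>insert i ?S. cmod (x v j))"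
    using fin by (simp add: \<rho>'_def sum_distrib_left norm_mult algebra_simps)
  also have "\<dots> \<le> \<rho> i * \<rho> v"
  proof (rule mult_mono)
    show "cmod (x i v) \<le> \<rho> i"
      unfolding \<rho>_def using finite_V v_in assms mutual_v[OF assms(1)]
      by (intro member_le_sum[where f = "\<lambda>j. cmod (x i j)"]) auto
    have "insert i ?S \<subseteq> {j \<in> V. j \<noteq> v \<and> mutual E v j}"
      using assms mutual_v[OF assms(1)] F_mutual[of i]
      by (auto simp: mutual_def intro: rtrancl_trans)
    then show "(\<Sum>j\<in>insert i ?S. cmod (x v j)) \<le> \<rho> v"
      unfolding \<rho>_def using finite_V by (intro sum_mono2) auto
  qed (auto simp: rho_nonneg sum_nonneg)
  finally show "\<rho>' i \<le> \<rho> i * \<rho> v - cmod (x i v * x v i)" by simp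
  then show "cmod (x i v * x v i) \<le> \<rho> i * \<rho> v" using rho'_nonneg[of i] by simp
qed

text \<open>Supplies the condition a < 1 of \<open>segment_bound\<close> when b is nonzero.\<close>

lemma two_cycle:
  assumes "i \<in> V - {v}" "x i v * x v i \<noteq> 0"
  shows "returns i" "\<rho> i * \<rho> v < 1"
proof -
  have "(i, v) \<in> E" "(v, i) \<in> E" using x_E[of i v] x_E[of v i] assms v_in by auto
  then show "returns i" by (auto simp: returns_def)
  have "cycle_list E [i, v]" using \<open>(i, v) \<in> E\<close> \<open>(v, i) \<in> E\<close> assms by (auto simp: cycle_list_def)
  from prod_rho_less_1[OF this] show "\<rho> i * \<rho> v < 1" using assms by simp
qed

text \<open>This is the whole inequality for a weak reduced cycle, whose row sum is 0.\<close>

lemma diag'_pos: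
  assumes "i \<in> V - {v}"
  shows "0 < diag' i"
proof -
  have "cmod (x i v * x v i) < 1"
    using two_cycle[OF assms] returns_rho'(2)[OF _ assms] by (cases "x i v * x v i = 0") fastforce+
  then show ?thesis by (auto simp: diag'_def)
qed

section \<open>Cycles of the reduced graph\<close>

text \<open>
  A path of the reduced graph from a successor of \<open>v\<close> to a predecessor of \<open>v\<close> is cut at its
  predecessors of \<open>v\<close>; closing up every piece through \<open>v\<close> gives a cycle of the original graph.
\<close>

lemma segment:
  assumes "us \<noteq> []" "distinct us" "successively (\<lambda>i j. (i, j) \<in> F) us" "set us \<subseteq> V - {v}"
    "\<And>i j. i \<in> set us \<Longrightarrow> j \<in> set us \<Longrightarrow> (i, j) \<in> E\<^sup>*" "(v, hd us) \<in> E" "returns (last us)"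
  shows "(\<Prod>i\<in>set us. \<rho>' i) < (\<Prod>i\<in>set us. diag' i)"
  using assms
proof (induction us rule: length_induct)
  case (1 us)
  have "\<exists>i\<in>set us. returns i" using 1 by auto
  \<comment> \<open>Cutting at the first returning vertex makes every step inside
    \<open>xs @ [i]\<close> an edge of \<open>E\<close>.\<close>
  then obtain xs i ys where us: "us = xs @ i # ys" and i: "returns i" and xs: "\<forall>j\<in>set xs. \<not> returns j"
    using split_list_first_prop[of us returns] by blast
  have iV: "i \<in> V - {v}" and xsV: "set xs \<subseteq> V - {v}" using 1 us by auto
  have succ: "successively (\<lambda>i j. (i, j) \<in> F) (xs @ [i])"
    using 1(4) us by (auto simp: successively_append_iff)
  have "successively (\<lambda>i j. (i, j) \<in> E) (xs @ [i])"
    unfolding successively_conv_nth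
  proof (intro allI impI)
    fix k assume k: "Suc k < length (xs @ [i])"
    then have "(xs @ [i]) ! k \<in> set xs" "(xs @ [i]) ! k \<in> set us" "(xs @ [i]) ! Suc k \<in> set us"
      using us by (auto simp: nth_append less_Suc_eq)
    then show "((xs @ [i]) ! k, (xs @ [i]) ! Suc k) \<in> E"
      using xs successively_nth[OF succ k] 1(6) by (intro not_returns_edge) blast+
  qed
  then have "cycle_list E (v # xs @ [i])"
    using 1(3,5,7) i us by (cases xs) (auto simp: cycle_list_def successively_Cons returns_def)
  from prod_rho_less_1[OF this] have "(\<Prod>j\<in>set xs. \<rho> j) * (\<rho> i * \<rho> v) < 1"
    using 1(3) us iV xsV by (simp add: prod.insert_if mult_ac insert_commute split: if_splits) (auto simp: mult_ac)
  then have "(\<Prod>j\<in>set xs. \<rho> j) * (\<rho> i * \<rho> v - cmod (x i v * x v i)) < 1 - cmod (x i v * x v i)"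
    using returns_rho'(2)[OF i iV] two_cycle(2)[OF iV] by (intro segment_bound) auto
  moreover have "(\<Prod>j\<in>set xs. \<rho>' j) * \<rho>' i \<le>
      (\<Prod>j\<in>set xs. \<rho> j) * (\<rho> i * \<rho> v - cmod (x i v * x v i))"
    using xs xsV not_returns_rho' returns_rho'(1)[OF i iV]
    by (intro mult_mono prod_mono) (auto simp: rho'_nonneg rho_nonneg intro!: prod_nonneg)
  moreover have "1 - cmod (x i v * x v i) \<le> diag' i"
    unfolding diag'_def using norm_triangle_ineq2[of 1 "x i v * x v i"] by simp
  moreover have "(\<Prod>j\<in>set xs. diag' j) = 1"
    using xs xsV not_returns_diag' by (intro prod.neutral) blast
  ultimately have seg: "(\<Prod>j\<in>set xs. \<rho>' j) * \<rho>' i < (\<Prod>j\<in>set xs. diag' j) * diag' i" by simp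
  show ?case
  proof (cases "ys = []")
    case True
    then show ?thesis using seg 1(3) us by (simp add: mult.commute)
  next
    case False
    have "(i, hd ys) \<in> F" "hd ys \<in> set us" "i \<noteq> hd ys" "i \<in> set us"
      using 1(3,4) us False by (auto simp: successively_append_iff successively_Cons)
    \<comment> \<open>The rest again starts at a successor of \<open>v\<close>, so the induction
      hypothesis applies to \<open>ys\<close>.\<close>
    then have "(v, hd ys) \<in> E" using returns_edge[OF i] 1(6) by blast
    then have IH: "(\<Prod>i\<in>set ys. \<rho>' i) < (\<Prod>i\<in>set ys. diag' i)"
      using 1(1)[rule_format, of ys] 1(3-) us False
      by (auto simp: successively_append_iff successively_Cons)
    have "((\<Prod>j\<in>set xs. \<rho>' j) * \<rho>' i) * (\<Prod>i\<in>set ys. \<rho>' i)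
        < ((\<Prod>j\<in>set xs. diag' j) * diag' i) * (\<Prod>i\<in>set ys. diag' i)"
      by (rule mult_strict_mono'[OF seg IH]) (auto simp: rho'_nonneg intro!: prod_nonneg mult_nonneg_nonneg)
    moreover have "(\<Prod>j\<in>set us. f j) = ((\<Prod>j\<in>set xs. f j) * f i) * (\<Prod>i\<in>set ys. f i)"
      for f :: "'a \<Rightarrow> real"
      using 1(3) us by (simp add: prod.union_disjoint mult_ac)
    ultimately show ?thesis by simp
  qed
qed

text \<open>A returning vertex, rotated to the end, makes the list start at a successor of
  \<open>v\<close>, as \<open>segment\<close> requires. Without one, the list is already a cycle of
  \<open>E\<close>, with diagonal 1 and rows no larger than before.\<close>

theorem reduced_cycle:
  assumes "cycle_list F us"
  shows "(\<Prod>i\<in>set us. \<rho>' i) < (\<Prod>i\<in>set us. diag' i)"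
proof -
  have usV: "set us \<subseteq> V - {v}" if "cycle_list F us" for us
  proof
    fix i assume i: "i \<in> set us"
    have "(i, i) \<in> F\<^sup>+"
    proof -
      have "(i, last us) \<in> F\<^sup>*" "(last us, hd us) \<in> F" "(hd us, i) \<in> F\<^sup>*"
        using that i by (auto simp: cycle_list_def intro: successively_rtrancl_hd successively_rtrancl_last)
      then show ?thesis by (meson rtrancl_into_trancl1 trancl_rtrancl_trancl)
    qed
    then show "i \<in> V - {v}" using F_sub by (metis (no_types, lifting) SigmaD1 subsetD tranclD)
  qed
  show ?thesis
  proof (cases "\<exists>i\<in>set us. returns i")
    case True
    then obtain i as bs where i: "returns i" and us: "us = as @ i # bs"
      by (meson split_list)
    then have c: "cycle_list F (bs @ as @ [i])"
      using assms cycle_list_swap[of F "as @ [i]" bs] by simp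
    let ?us = "bs @ as @ [i]"
    have hd: "hd ?us \<in> set ?us" "(i, hd ?us) \<in> F" "i \<noteq> hd ?us"
      using c by (cases bs; cases as; auto simp: cycle_list_def)+
    then have "(v, hd ?us) \<in> E"
      using cycle_list_rtrancl[OF c hd(1), of i] F_rtrancl by (intro returns_edge[OF i]) auto
    then have "(\<Prod>i\<in>set ?us. \<rho>' i) < (\<Prod>i\<in>set ?us. diag' i)"
      using c i usV[OF c] cycle_list_rtrancl[OF c] F_rtrancl
      by (intro segment) (auto simp: cycle_list_def)
    moreover have "set ?us = set us" using us by auto
    ultimately show ?thesis by simp
  next
    case False
    have V: "set us \<subseteq> V - {v}" using usV[OF assms] .
    have "successively (\<lambda>i j. (i, j) \<in> E) us"
      using assms False not_returns_edge cycle_list_rtrancl[OF assms] F_rtrancl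
      by (auto simp: cycle_list_def elim!: successively_mono)
    moreover have "last us \<in> set us" "hd us \<in> set us"
      using assms by (auto simp: cycle_list_def intro!: last_in_set hd_in_set)
    then have "(last us, hd us) \<in> E"
      using assms False not_returns_edge cycle_list_rtrancl[OF assms] F_rtrancl
      by (auto simp: cycle_list_def)
    ultimately have "cycle_list E us" using assms by (auto simp: cycle_list_def)
    from prod_rho_less_1[OF this] have "(\<Prod>i\<in>set us. \<rho> i) < 1" .
    moreover have "(\<Prod>i\<in>set us. \<rho>' i) \<le> (\<Prod>i\<in>set us. \<rho> i)"
      using False V not_returns_rho' by (intro prod_mono) (auto simp: rho'_nonneg)
    moreover have "(\<Prod>i\<in>set us. diag' i) = 1"
      using False V not_returns_diag' by (intro prod.neutral) blast
    ultimately show ?thesis by simp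
  qed
qed

end

section \<open>Cycles and components of weighted digraphs\<close>

lemma wf_digraph_of: "H \<in> graphs \<Longrightarrow> wf_digraph (digraph_of H)"
  by unfold_locales (auto simp: digraph_of_def graphs_def)

lemma arcs_ends_digraph_of: "arcs_ends (digraph_of H) = edges H"
  by (simp add: arcs_ends_def arc_to_ends_def digraph_of_def)

lemma verts_digraph_of: "verts (digraph_of H) = vertices H"
  by (simp add: digraph_of_def)

lemma reachable_digraph_of:
  assumes "H \<in> graphs"
  shows "i \<rightarrow>\<^sup>*\<^bsub>digraph_of H\<^esub> j \<longleftrightarrow>
    i \<in> vertices H \<and> j \<in> vertices H \<and> (i, j) \<in> (edges H)\<^sup>*"
  using wf_digraph.reachable_conv[OF wf_digraph_of[OF assms]]
  by (auto simp: arcs_ends_digraph_of verts_digraph_of)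

lemma same_scc_iff:
  assumes "H \<in> graphs"
  shows "same_scc H i j \<longleftrightarrow> i \<in> vertices H \<and> j \<in> vertices H \<and> mutual (edges H) i j"
proof -
  interpret wf_digraph "digraph_of H" using assms by (rule wf_digraph_of)
  have "same_scc H i j \<longleftrightarrow> (\<exists>S\<in>sccs_verts. i \<in> S \<and> j \<in> S)"
    unfolding same_scc_def sccs_verts_conv by auto
  also have "\<dots> \<longleftrightarrow> i \<rightarrow>\<^sup>*\<^bsub>digraph_of H\<^esub> j \<and> j \<rightarrow>\<^sup>*\<^bsub>digraph_of H\<^esub> i"
  proof
    assume "\<exists>S\<in>sccs_verts. i \<in> S \<and> j \<in> S"
    then show "i \<rightarrow>\<^sup>*\<^bsub>digraph_of H\<^esub> j \<and> j \<rightarrow>\<^sup>*\<^bsub>digraph_of H\<^esub> i"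
      by (auto simp: in_sccs_verts_conv_reachable)
  next
    assume r: "i \<rightarrow>\<^sup>*\<^bsub>digraph_of H\<^esub> j \<and> j \<rightarrow>\<^sup>*\<^bsub>digraph_of H\<^esub> i"
    then have "i \<in> verts (digraph_of H)" by (auto simp: reachable_in_verts(1))
    then have "scc_of i \<in> sccs_verts" "i \<in> scc_of i"
      by (rule scc_of_in_sccs_verts, rule in_scc_of_self)
    moreover have "j \<in> scc_of i" using r by (simp add: scc_of_def)
    ultimately show "\<exists>S\<in>sccs_verts. i \<in> S \<and> j \<in> S" by blast
  qed
  finally show ?thesis by (auto simp: reachable_digraph_of[OF assms] mutual_def)
qed

text \<open>Components are induced subgraphs, so they contain every edge between their
  vertices.\<close>

lemma edges_sccI:
  assumes "(i, j) \<in> edges H" "same_scc H i j"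
  shows "(i, j) \<in> edges_scc H"
proof -
  obtain S where S: "S \<in> pre_digraph.sccs (digraph_of H)" "i \<in> verts S" "j \<in> verts S"
    using assms(2) by (auto simp: same_scc_def)
  then have "induced_subgraph S (digraph_of H)"
    by (simp add: pre_digraph.in_sccs_imp_induced)
  then have "arcs S = {e \<in> edges H. fst e \<in> verts S \<and> snd e \<in> verts S}"
    by (simp add: induced_subgraph_def digraph_of_def)
  with S assms(1) show ?thesis by (auto simp: edges_scc_def)
qed

lemma cyc_verts_cyc_of [simp]: "cyc_verts (cyc_of us) = set us"
  by (auto simp: cyc_verts_def cyc_of_def)

text \<open>Each vertex of the list has an outgoing edge, hence is a vertex of the graph.\<close>

lemma strong_cycles_eq:
  assumes "H \<in> graphs"
  shows "strong_cycles H = {cyc_of us | us. cycle_list (edges H) us}"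
proof -
  have "set us \<subseteq> vertices H" if "cycle_list (edges H) us" for us
  proof
    fix i assume i: "i \<in> set us"
    have "(i, last us) \<in> (edges H)\<^sup>*" "(last us, hd us) \<in> edges H"
      using that i by (auto simp: cycle_list_def intro: successively_rtrancl_last)
    then have "i \<in> Domain (edges H)" by (metis DomainI converse_rtranclE)
    then show "i \<in> vertices H" using assms by (auto simp: graphs_def)
  qed
  then show ?thesis
    by (auto simp: strong_cycles_def cycle_list_def successively_conv_nth)
qed

text \<open>A vertex on no strong cycle forms a weak one. Hence each diagonal factor enters some
  cycle inequality and cannot vanish outside the region.\<close>

lemma vertex_in_cycle:
  assumes "i \<in> vertices H"
  obtains \<gamma> where "\<gamma> \<in> cycles H" "i \<in> cyc_verts \<gamma>"
proof (cases "\<exists>\<gamma>\<in>strong_cycles H. i \<in> cyc_verts \<gamma>")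
  case False
  then have "cyc_of [i] \<in> weak_cycles H"
    using assms unfolding weak_cycles_def by blast
  with that[of "cyc_of [i]"] show thesis by (simp add: cycles_def)
qed (auto simp: cycles_def intro: that)

lemma finite_cyc_verts:
  assumes "\<gamma> \<in> cycles H"
  shows "finite (cyc_verts \<gamma>)" "cyc_verts \<gamma> \<subseteq> vertices H"
  using assms by (auto simp: cycles_def strong_cycles_def weak_cycles_def)

section \<open>Graph structure and values of the polynomial extension\<close>

lemma rowden_nonzero: "rowden G i \<noteq> 0"
  by (cases "finite (vertices G)") (simp_all add: rowden_def denom_nonzero)

lemma vertices_poly_ext [simp]: "vertices (poly_ext G) = vertices G"
  by (simp add: poly_ext_def)

lemma poly_ext_graphs: "G \<in> graphs \<Longrightarrow> poly_ext G \<in> graphs"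
  by (auto simp: graphs_def edges_def poly_ext_def)

text \<open>Off the diagonal a weight is only scaled by a nonzero factor. Loops may appear or
  vanish, but cycles and components do not see them.\<close>

lemma edges_poly_ext:
  assumes "G \<in> graphs"
  shows "edges (poly_ext G) - Id = edges G - Id"
  using assms by (auto simp: graphs_def edges_def poly_ext_def rowden_nonzero)

lemma cycle_list_minus_Id: "cycle_list (E - Id) us = cycle_list E us"
proof
  assume "cycle_list E us"
  then have d: "distinct us" "2 \<le> length us" "(last us, hd us) \<in> E"
    and s: "\<And>k. Suc k < length us \<Longrightarrow> (us ! k, us ! Suc k) \<in> E"
    by (auto simp: cycle_list_def successively_conv_nth)
  have "last us \<noteq> hd us" using d(1,2) by (cases us) auto
  moreover have "us ! k \<noteq> us ! Suc k" if "Suc k < length us" for k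
    using d(1) that by (simp add: nth_eq_iff_index_eq)
  ultimately show "cycle_list (E - Id) us"
    using d s by (simp add: cycle_list_def successively_conv_nth)
qed (auto simp: cycle_list_def elim: successively_mono)

lemma mutual_minus_Id: "mutual (E - Id) = mutual E"
  by (auto simp: mutual_def rtrancl_r_diff_Id fun_eq_iff)

lemma cycles_poly_ext:
  assumes "G \<in> graphs"
  shows "cycles (poly_ext G) = cycles G"
proof -
  have "strong_cycles (poly_ext G) = strong_cycles G"
    using strong_cycles_eq[OF assms] strong_cycles_eq[OF poly_ext_graphs[OF assms]]
      cycle_list_minus_Id[of "edges G"] cycle_list_minus_Id[of "edges (poly_ext G)"]
    by (simp add: edges_poly_ext[OF assms])
  then show ?thesis by (simp add: cycles_def weak_cycles_def)
qed

lemma same_scc_poly_ext: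
  assumes "G \<in> graphs"
  shows "same_scc (poly_ext G) = same_scc G"
  using same_scc_iff[OF assms] same_scc_iff[OF poly_ext_graphs[OF assms]]
    mutual_minus_Id[of "edges G"] mutual_minus_Id[of "edges (poly_ext G)"]
  by (simp add: fun_eq_iff edges_poly_ext[OF assms])

lemma r_tilde_poly_ext:
  assumes "G \<in> graphs" "i \<in> vertices G"
  shows "r_tilde (poly_ext G) i z =
    (\<Sum>j\<in>{j \<in> vertices G. j \<noteq> i \<and> mutual (edges G) i j}. cmod (ev (weight (poly_ext G) i j) z))"
  unfolding r_tilde_def using assms
  by (intro sum.cong) (auto simp: same_scc_poly_ext same_scc_iff)

lemma ev_to_fract [simp]: "ev (to_fract p) z = poly p z"
  by (simp add: ev_def numer_def denom_def)

text \<open>One polynomial carries both the rational identity and the values, so identities are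
  proved among fractions and then evaluated.\<close>

lemma poly_ext_off_diag:
  assumes "finite (vertices G)" "i \<in> vertices G" "j \<in> vertices G" "i \<noteq> j"
  obtains p where "to_fract p = to_fract (rowden G i) * weight G i j"
    "\<And>z. ev (weight (poly_ext G) i j) z = poly p z"
proof -
  obtain p where p: "to_fract (rowden G i) * weight G i j = to_fract p"
    using rowden_times[OF assms(1,3)] by blast
  then have "weight (poly_ext G) i j = to_fract p" using assms by (simp add: poly_ext_def)
  with p show thesis by (intro that[of p]) auto
qed

text \<open>The explicit form has every other denominator of the row as a factor, so a nonzero value
  at z excludes poles of the off-diagonal entries there.\<close>

lemma poly_ext_diag:
  assumes "finite (vertices G)" "i \<in> vertices G"
  obtains p where "to_fract p = to_fract (rowden G i) * (Lam - weight G i i)"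
    "\<And>z. z - ev (weight (poly_ext G) i i) z = poly p z"
    "p = ([:0, 1:] * denom (weight G i i) - numer (weight G i i)) *
      (\<Prod>j\<in>vertices G - {i}. denom (weight G i j))"
proof -
  define p where "p = ([:0, 1:] * denom (weight G i i) - numer (weight G i i)) *
      (\<Prod>j\<in>vertices G - {i}. denom (weight G i j))"
  have r: "rowden G i = denom (weight G i i) * (\<Prod>j\<in>vertices G - {i}. denom (weight G i j))"
    using assms by (simp add: rowden_def prod.remove)
  have p: "to_fract p = to_fract (rowden G i) * (Lam - weight G i i)"
    unfolding p_def r to_fract_mult to_fract_diff denom_times[symmetric] Lam_def
    by (simp only: algebra_simps)
  then have "weight (poly_ext G) i i = to_fract ([:0, 1:] - p)"
    using assms by (simp add: poly_ext_def algebra_simps flip: Lam_def)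
  then have "z - ev (weight (poly_ext G) i i) z = poly p z" for z
    by (simp del: to_fract_diff)
  then show thesis using p by (intro that[of p] p_def)
qed

section \<open>Orders of the row denominators\<close>

lemma denom_dvd:
  assumes "to_fract q * w = to_fract p"
  shows "denom w dvd q"
proof -
  have "to_fract (q * numer w) = to_fract (p * denom w)"
    unfolding to_fract_mult denom_times[symmetric] assms[symmetric] by (simp add: mult_ac)
  then have "q * numer w = p * denom w" by (simp only: to_fract_eq_iff)
  then have "denom w dvd numer w * q" by (metis dvd_triv_right mult.commute)
  moreover have "coprime (denom w) (numer w)"
    unfolding numer_def denom_def using coprime_quot_of_fract[of w] by (simp add: coprime_commute)
  ultimately show ?thesis by (simp add: coprime_dvd_mult_right_iff)
qed

text \<open>The difference f/e is regular at z, so w' has no worse pole there than w.\<close>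

lemma order_denom_le:
  assumes "to_fract e * w' = to_fract e * w + to_fract f" "poly e z \<noteq> 0"
  shows "order z (denom w') \<le> order z (denom w)"
proof -
  have "to_fract (denom w * e) * w' = to_fract (denom w) * (to_fract e * w')" by (simp add: mult_ac)
  also have "\<dots> = to_fract (e * numer w + denom w * f)"
    unfolding assms(1) to_fract_add to_fract_mult denom_times[symmetric] by (simp add: algebra_simps)
  finally have "denom w' dvd denom w * e" by (rule denom_dvd)
  moreover have "denom w * e \<noteq> 0" using denom_nonzero assms(2) by auto
  ultimately have "order z (denom w') \<le> order z (denom w * e)" by (intro dvd_imp_order_le)
  then show ?thesis using \<open>denom w * e \<noteq> 0\<close> assms(2) by (simp add: order_mult order_0I)
qed

lemma order_rowden:
  assumes "finite (vertices G)" "i \<in> vertices G"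
    "\<And>j. j \<in> vertices G - {i} \<Longrightarrow> poly (denom (weight G i j)) z \<noteq> 0"
  shows "order z (rowden G i) = order z (denom (weight G i i))"
proof -
  have r: "rowden G i = denom (weight G i i) * (\<Prod>j\<in>vertices G - {i}. denom (weight G i j))"
    using assms by (simp add: rowden_def prod.remove)
  have "poly (\<Prod>j\<in>vertices G - {i}. denom (weight G i j)) z \<noteq> 0"
    using assms by (simp add: poly_prod)
  then show ?thesis
    using rowden_nonzero[of G i] unfolding r by (simp add: order_mult order_0I)
qed

text \<open>\<open>h\<close> is the common power of the linear factor at z; p/q = a/b is thus
  regular and nonzero at z.\<close>

lemma equal_order_cofactors:
  fixes p q :: "complex poly"
  assumes "p \<noteq> 0" "q \<noteq> 0" "order z p = order z q"
  obtains h a b where "p = h * a" "q = h * b" "poly a z \<noteq> 0" "poly b z \<noteq> 0"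
proof -
  obtain a where a: "p = [:- z, 1:] ^ order z p * a" "\<not> [:- z, 1:] dvd a"
    using order_decomp[OF assms(1)] by blast
  obtain b where b: "q = [:- z, 1:] ^ order z p * b" "\<not> [:- z, 1:] dvd b"
    using order_decomp[OF assms(2)] assms(3) by metis
  show thesis using a b by (intro that[of "[:- z, 1:] ^ order z p" a b]) (auto simp: poly_eq_0_iff_dvd)
qed

section \<open>Rows of the reduced graph at a point\<close>

lemma vertices_remove_vertex [simp]: "vertices (remove_vertex G v) = vertices G - {v}"
  by (simp add: remove_vertex_def)

lemma remove_vertex_graphs:
  assumes "G \<in> graphs" "2 \<le> card (vertices G)"
  shows "remove_vertex G v \<in> graphs"
proof -
  have "vertices G - {v} \<noteq> {}"
  proof
    assume "vertices G - {v} = {}"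
    then have "card (vertices G) \<le> card {v}" by (intro card_mono) auto
    with assms(2) show False by simp
  qed
  with assms(1) show ?thesis by (auto simp: graphs_def edges_def remove_vertex_def)
qed

text \<open>
  The normalised entry \<open>M_ij / (\<lambda> - M_ii)\<close> at \<open>\<lambda> = z\<close>. Passing to the polynomial extension
  multiplies numerator and denominator by \<open>L_i\<close>, so this also makes sense when \<open>M_ii\<close> has a pole
  at \<open>z\<close>.
\<close>

definition normalized :: "'a wdigraph \<Rightarrow> complex \<Rightarrow> 'a \<Rightarrow> 'a \<Rightarrow> complex" where
  "normalized G z i j =
     ev (weight (poly_ext G) i j) z / (z - ev (weight (poly_ext G) i i) z)"

text \<open>The row factor of \<open>v\<close> cancels in the reduction. Clearing the other
  denominators turns each entry formula into a polynomial identity, which can be evaluated at z even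
  if \<open>weight G i i\<close> has a pole there.\<close>

lemma reduced_row:
  assumes G: "G \<in> graphs_pi" and v: "v \<in> vertices G" and i: "i \<in> vertices G - {v}"
    and di: "z - ev (weight (poly_ext G) i i) z \<noteq> 0"
    and dv: "z - ev (weight (poly_ext G) v v) z \<noteq> 0"
  defines "R \<equiv> remove_vertex G v" and "x \<equiv> normalized G z"
  obtains c where "c \<noteq> 0"
    "z - ev (weight (poly_ext R) i i) z = c * (1 - x i v * x v i)"
    "\<And>j. j \<in> vertices R \<Longrightarrow> j \<noteq> i \<Longrightarrow>
      ev (weight (poly_ext R) i j) z = c * (x i j + x i v * x v j)"
proof -
  have fin: "finite (vertices G)" using G by (simp add: graphs_pi_def graphs_def)
  have VR [simp]: "vertices R = vertices G - {v}" by (simp add: R_def)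
  have fin': "finite (vertices R)" using fin by simp
  have i': "i \<in> vertices G" "i \<noteq> v" "i \<in> vertices R" using i by auto
  obtain p where p: "to_fract p = to_fract (rowden G i) * (Lam - weight G i i)"
    "\<And>z. z - ev (weight (poly_ext G) i i) z = poly p z"
    "p = ([:0, 1:] * denom (weight G i i) - numer (weight G i i)) *
      (\<Prod>j\<in>vertices G - {i}. denom (weight G i j))"
    using poly_ext_diag[OF fin i'(1)] by blast
  obtain q where q: "to_fract q = to_fract (rowden G v) * (Lam - weight G v v)"
    "\<And>z. z - ev (weight (poly_ext G) v v) z = poly q z"
    using poly_ext_diag[OF fin v] by blast
  obtain p' where p': "to_fract p' = to_fract (rowden R i) * (Lam - weight R i i)"
    "\<And>z. z - ev (weight (poly_ext R) i i) z = poly p' z"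
    using poly_ext_diag[OF fin' i'(3)] by blast
  obtain s where s: "to_fract s = to_fract (rowden G i) * weight G i v"
    "\<And>z. ev (weight (poly_ext G) i v) z = poly s z"
    using poly_ext_off_diag[OF fin i'(1) v i'(2)] by blast
  have pz: "poly p z \<noteq> 0" and qz: "poly q z \<noteq> 0" using di dv p q by auto
  have regular: "poly (denom (weight G i j)) z \<noteq> 0" if "j \<in> vertices G - {i}" for j
    using pz that fin unfolding p(3) by (auto simp: poly_prod)
  have q0: "to_fract q \<noteq> 0" using qz by auto
  have rv0: "to_fract (rowden G v) \<noteq> 0" by (simp add: rowden_nonzero)
  have W: "to_fract q * weight R i j = to_fract q * weight G i j + weight G i v * to_fract t"
    if "j \<in> vertices R" "to_fract t = to_fract (rowden G v) * weight G v j" for j t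
  proof -
    have "Lam - weight G v v = to_fract q / to_fract (rowden G v)"
      using q(1) rv0 by (simp add: field_simps)
    moreover have "weight G v j = to_fract t / to_fract (rowden G v)"
      using that(2) rv0 by (simp add: field_simps)
    ultimately have "weight R i j = weight G i j + weight G i v * to_fract t / to_fract q"
      using that(1) i' rv0 by (simp add: R_def remove_vertex_def)
    then show ?thesis using q0 by (simp add: field_simps)
  qed
  \<comment> \<open>The factor \<open>denom (weight G i v)\<close> makes the correction a
    polynomial; since \<open>v\<close> is not \<open>i\<close>, it does not vanish at z.\<close>
  define e where "e = q * denom (weight G i v)"
  have ez: "poly e z \<noteq> 0" using qz regular[of v] v i by (auto simp: e_def)
  have E: "to_fract e * weight R i j = to_fract e * weight G i j + to_fract (numer (weight G i v) * t)"
    if "j \<in> vertices R" "to_fract t = to_fract (rowden G v) * weight G v j" for j t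
  proof -
    have "to_fract e * weight R i j = to_fract (denom (weight G i v)) * (to_fract q * weight R i j)"
      by (simp add: e_def mult_ac)
    also have "\<dots> = to_fract e * weight G i j + to_fract (numer (weight G i v) * t)"
      unfolding W[OF that] e_def to_fract_mult denom_times[symmetric] by (simp add: algebra_simps)
    finally show ?thesis .
  qed
  have t: "\<exists>t. to_fract t = to_fract (rowden G v) * weight G v j \<and>
      ev (weight (poly_ext G) v j) z = poly t z" if "j \<in> vertices R" for j
    using poly_ext_off_diag[OF fin v, of j] that by (metis DiffE VR singletonI)
  have le: "order z (denom (weight R i j)) \<le> order z (denom (weight G i j))"
    if "j \<in> vertices R" for j
    using t[OF that] order_denom_le[OF E[OF that] ez] by blast
  \<comment> \<open>With the correction moved to the other side the bound reverses, so the pole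
    orders on the diagonal agree.\<close>
  have "order z (denom (weight G i i)) \<le> order z (denom (weight R i i))"
  proof -
    obtain t where "to_fract t = to_fract (rowden G v) * weight G v i" using t[OF i'(3)] by blast
    then have "to_fract e * weight G i i =
        to_fract e * weight R i i + to_fract (- (numer (weight G i v) * t))"
      using E[OF i'(3)] by simp
    then show ?thesis using ez by (rule order_denom_le)
  qed
  then have "order z (denom (weight R i i)) = order z (denom (weight G i i))"
    using le[OF i'(3)] by simp
  moreover have "poly (denom (weight R i j)) z \<noteq> 0" if "j \<in> vertices R - {i}" for j
    using le[of j] regular[of j] that denom_nonzero by (auto simp: order_root)
  ultimately have "order z (rowden R i) = order z (rowden G i)"
    using order_rowden[OF fin i'(1) regular] order_rowden[OF fin' i'(3)] by auto
  then obtain h a b where h: "rowden R i = h * a" "rowden G i = h * b"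
    and az: "poly a z \<noteq> 0" and bz: "poly b z \<noteq> 0"
    using equal_order_cofactors[OF rowden_nonzero rowden_nonzero] by metis
  \<comment> \<open>\<open>poly p z\<close> undoes the normalisation of row \<open>i\<close>, and
    a/b is the change of its row denominator.\<close>
  define c where "c = poly a z * poly p z / poly b z"
  have off: "ev (weight (poly_ext R) i j) z = c * (x i j + x i v * x v j)"
    if j: "j \<in> vertices R" "j \<noteq> i" for j
  proof -
    obtain t where t: "to_fract t = to_fract (rowden G v) * weight G v j"
      "ev (weight (poly_ext G) v j) z = poly t z" using t[OF j(1)] by blast
    obtain m where m: "to_fract m = to_fract (rowden G i) * weight G i j"
      "\<And>z. ev (weight (poly_ext G) i j) z = poly m z"
      using poly_ext_off_diag[OF fin i'(1), of j] j by auto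
    obtain m' where m': "to_fract m' = to_fract (rowden R i) * weight R i j"
      "\<And>z. ev (weight (poly_ext R) i j) z = poly m' z"
      using poly_ext_off_diag[OF fin' i'(3) j(1)] j by metis
    \<comment> \<open>\<open>b\<close> trades row denominators, as
      \<open>b * rowden R i = a * rowden G i\<close>; \<open>q\<close> clears the division by the
      diagonal entry of \<open>v\<close>.\<close>
    have "to_fract (b * q * m') = to_fract a * to_fract (rowden G i) * (to_fract q * weight R i j)"
      by (simp add: m' h mult_ac)
    also have "\<dots> = to_fract (a * (q * m + s * t))"
      unfolding W[OF j(1) t(1)] by (simp add: m s algebra_simps)
    finally have "b * q * m' = a * (q * m + s * t)" by (simp only: to_fract_eq_iff)
    then have "poly b z * poly q z * poly m' z = poly a z * (poly q z * poly m z + poly s z * poly t z)"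
      by (metis poly_add poly_mult)
    then have "poly m' z = poly a z * (poly q z * poly m z + poly s z * poly t z) / (poly b z * poly q z)"
      using bz qz by (simp add: field_simps)
    moreover have "c * (x i j + x i v * x v j) = poly a z * (poly q z * poly m z + poly s z * poly t z) / (poly b z * poly q z)"
      using bz qz pz by (simp add: x_def normalized_def m t s p(2) q(2) c_def field_simps)
    ultimately show ?thesis by (simp add: m')
  qed
  have diag: "z - ev (weight (poly_ext R) i i) z = c * (1 - x i v * x v i)"
  proof -
    obtain t where t: "to_fract t = to_fract (rowden G v) * weight G v i"
      "ev (weight (poly_ext G) v i) z = poly t z" using t[OF i'(3)] by blast
    have "to_fract (b * q * p') =
        to_fract a * to_fract (rowden G i) * (to_fract q * Lam - to_fract q * weight R i i)"
      by (simp add: p' h algebra_simps)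
    also have "\<dots> = to_fract (a * (q * p - s * t))"
      unfolding W[OF i'(3) t(1)] by (simp add: p(1) s algebra_simps)
    finally have "b * q * p' = a * (q * p - s * t)" by (simp only: to_fract_eq_iff)
    then have "poly b z * poly q z * poly p' z = poly a z * (poly q z * poly p z - poly s z * poly t z)"
      by (metis poly_diff poly_mult)
    then have "poly p' z = poly a z * (poly q z * poly p z - poly s z * poly t z) / (poly b z * poly q z)"
      using bz qz by (simp add: field_simps)
    moreover have "c * (1 - x i v * x v i) = poly a z * (poly q z * poly p z - poly s z * poly t z) / (poly b z * poly q z)"
      using bz qz pz by (simp add: x_def normalized_def t s p(2) q(2) c_def field_simps)
    ultimately show ?thesis by (simp add: p')
  qed
  show thesis using az bz pz off diag by (intro that[of c]) (auto simp: c_def)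
qed

section \<open>The hypotheses on the removed vertex\<close>

text \<open>Rotation by 0 < k < length ends in entry k - 1, which differs from the last one.\<close>

lemma last_rotate_distinct:
  assumes "distinct us" "last (rotate n us) = last us" "us \<noteq> []"
  shows "rotate n us = us"
proof -
  define k where "k = n mod length us"
  have k: "k < length us" "rotate n us = drop k us @ take k us"
    using assms(3) by (simp_all add: k_def rotate_drop_take)
  have "k = 0"
  proof (rule ccontr)
    assume "k \<noteq> 0"
    then have "take k us \<noteq> []" using k assms(3) by simp
    then have "last (rotate n us) = last (take k us)" using k(2) by (simp del: take_eq_Nil)
    also have "\<dots> = us ! (k - 1)"
      using k \<open>k \<noteq> 0\<close> by (subst last_conv_nth) auto
    finally have "last (rotate n us) = us ! (k - 1)" .
    then have "us ! (k - 1) = us ! (length us - 1)"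
      using assms by (simp add: last_conv_nth)
    then show False using assms(1) k(1) \<open>k \<noteq> 0\<close> by (simp add: nth_eq_iff_index_eq)
  qed
  with k show ?thesis by simp
qed

text \<open>
  A cycle through the edge \<open>(i, j)\<close> must pass through \<open>v\<close>, and read from \<open>v\<close> on it can
  only return to \<open>v\<close> from its last vertex, which is therefore \<open>i\<close>; so \<open>j = v\<close>.
\<close>

lemma only_edge_to_v:
  assumes G: "G \<in> graphs" and A: "cycles_adjacent v G = {}"
    and S: "cycles_through v G = cycles_S v G"
    and iv: "(i, v) \<in> edges G" "(v, i) \<in> (edges G)\<^sup>*" "i \<noteq> v"
    and ij: "(i, j) \<in> edges G" "(j, i) \<in> (edges G)\<^sup>*" "i \<noteq> j"
  shows "j = v"
proof -
  obtain us where us: "cycle_list (edges G) us" "hd us = j" "last us = i" "i \<in> set us"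
    using edge_cycle_list[OF ij] by blast
  have cyc: "cyc_of us \<in> cycles G"
    using us(1) by (auto simp: cycles_def strong_cycles_eq[OF G])
  have "same_scc G i v"
    using iv G by (auto simp: same_scc_iff mutual_def graphs_def)
  then have "(i, v) \<in> edges_scc G" using iv by (intro edges_sccI)
  moreover have "cyc_of us \<notin> cycles_adjacent v G" using A by simp
  \<comment> \<open>Otherwise the edge from \<open>i\<close> to \<open>v\<close> would make this
    cycle adjacent to \<open>v\<close>.\<close>
  ultimately have "v \<in> set us"
    using cyc us(4) unfolding cycles_adjacent_def mem_Collect_eq cyc_verts_cyc_of by blast
  then have "cyc_of us \<in> cycles_through v G" using cyc by (simp add: cycles_through_def)
  then have "cyc_of us \<in> cycles_S v G" using S by simp
  moreover have "length ws \<noteq> 1" if "ws \<in> cyc_of us" for ws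
    using that us(1) by (auto simp: cyc_of_def cycle_list_def)
  ultimately obtain n where n: "hd (rotate n us) = v"
    "\<And>k. 0 < k \<Longrightarrow> Suc k < length us \<Longrightarrow> (rotate n us ! k, v) \<notin> edges G"
    unfolding cycles_S_def cyc_of_def by auto
  have "i \<in> set (rotate n us)" using us(4) by simp
  then obtain k where k: "k < length us" "rotate n us ! k = i" by (metis in_set_conv_nth length_rotate)
  have ne: "us \<noteq> []" using us(4) by auto
  have "k \<noteq> 0" using n(1) k(2) iv(3) ne by (metis hd_conv_nth rotate_is_Nil_conv)
  \<comment> \<open>At a position strictly between the ends, the edge \<open>(i, v)\<close> would
    violate \<open>cycles_S\<close>.\<close>
  then have "Suc k = length us" using n(2)[of k] k iv(1) by (cases "Suc k < length us") auto
  then have "k = length us - 1" by simp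
  then have "last (rotate n us) = last us"
    using k(2) us(3) ne by (simp add: last_conv_nth)
  then have "rotate n us = us"
    using us(1) ne by (intro last_rotate_distinct) (auto simp: cycle_list_def)
  then show ?thesis using n(1) us(2) by simp
qed

section \<open>Inclusion of the regions\<close>

theorem theorem5p4:
  fixes G :: "'a wdigraph" and v :: 'a
  assumes "G \<in> graphs_pi"
    and "2 \<le> card (vertices G)"
    and "v \<in> vertices G"
    and "cycles_adjacent v G = {}"
    and "cycles_through v G = cycles_S v G"
  shows "BW_B (remove_vertex G v) \<subseteq> BW_B G"
proof
  fix z assume zR: "z \<in> BW_B (remove_vertex G v)"
  define R where "R = remove_vertex G v"
  have G: "G \<in> graphs" using assms(1) by (simp add: graphs_pi_def)
  have R: "R \<in> graphs" using remove_vertex_graphs[OF G assms(2)] by (simp add: R_def)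
  have VR: "vertices R = vertices G - {v}" by (simp add: R_def)
  let ?d = "\<lambda>H i. z - ev (weight (poly_ext H) i i) z"
  let ?r = "\<lambda>H i. r_tilde (poly_ext H) i z"
  show "z \<in> BW_B G"
  proof (rule ccontr)
    assume "z \<notin> BW_B G"
    then have less: "(\<Prod>i\<in>cyc_verts \<gamma>. ?r G i) < (\<Prod>i\<in>cyc_verts \<gamma>. cmod (?d G i))"
      if "\<gamma> \<in> cycles G" for \<gamma>
      using that cycles_poly_ext[OF G] by (force simp: BW_B_def not_le)
    have r_nonneg: "0 \<le> ?r H i" for H :: "'a wdigraph" and i
      by (simp add: r_tilde_def sum_nonneg)
    have d0: "?d G i \<noteq> 0" if i: "i \<in> vertices G" for i
    proof -
      obtain \<gamma> where \<gamma>: "\<gamma> \<in> cycles G" "i \<in> cyc_verts \<gamma>" using vertex_in_cycle[OF i] by blast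
      have "0 \<le> (\<Prod>i\<in>cyc_verts \<gamma>. ?r G i)" using r_nonneg by (intro prod_nonneg) auto
      with less[OF \<gamma>(1)] have "(\<Prod>i\<in>cyc_verts \<gamma>. cmod (?d G i)) \<noteq> 0" by linarith
      then show ?thesis using \<gamma> finite_cyc_verts[OF \<gamma>(1)] by auto
    qed
    define x where "x = normalized G z"
    \<comment> \<open>Division by the diagonal factors turns each cycle inequality into a bound by
      1.\<close>
    have r_eq: "?r G i = cmod (?d G i) *
        (\<Sum>j\<in>{j \<in> vertices G. j \<noteq> i \<and> mutual (edges G) i j}. cmod (x i j))"
      if i: "i \<in> vertices G" for i
      using d0[OF i] i
      by (simp add: r_tilde_poly_ext[OF G] x_def normalized_def sum_distrib_left norm_divide)
    interpret vertex_reduction "vertices G" "edges G" "edges R" v x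
    proof
      show "finite (vertices G)" using G by (simp add: graphs_def)
      show "edges R \<subseteq> (vertices G - {v}) \<times> (vertices G - {v})"
        using R by (simp add: graphs_def VR)
      show "(i, j) \<in> edges G \<or> (i, v) \<in> edges G \<and> (v, j) \<in> edges G" if "(i, j) \<in> edges R" for i j
        using that by (auto simp: R_def edges_def remove_vertex_def split: if_splits)
      show "(i, j) \<in> edges G" if "i \<in> vertices G" "j \<in> vertices G" "i \<noteq> j" "x i j \<noteq> 0" for i j
        using that by (auto simp: x_def normalized_def poly_ext_def edges_def ev_def numer_def)
      fix us assume us: "cycle_list (edges G) us"
      then have cyc: "cyc_of us \<in> cycles G" by (auto simp: cycles_def strong_cycles_eq[OF G])
      have V: "set us \<subseteq> vertices G" using finite_cyc_verts[OF cyc] by simp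
      let ?\<rho> = "\<lambda>i. \<Sum>j\<in>{j \<in> vertices G. j \<noteq> i \<and> mutual (edges G) i j}. cmod (x i j)"
      have "(\<Prod>i\<in>set us. ?r G i) = (\<Prod>i\<in>set us. cmod (?d G i)) * (\<Prod>i\<in>set us. ?\<rho> i)"
        unfolding prod.distrib[symmetric] using V r_eq by (intro prod.cong) auto
      moreover have "0 < (\<Prod>i\<in>set us. cmod (?d G i))" using V d0 by (intro prod_pos) auto
      ultimately show "(\<Prod>i\<in>set us. ?\<rho> i) < 1" using less[OF cyc] by simp
    qed (use only_edge_to_v[OF G assms(4,5)] assms(3) in auto)
    have "\<exists>c. c \<noteq> 0 \<and> ?d R i = c * (1 - x i v * x v i) \<and>
        (\<forall>j\<in>vertices R. j \<noteq> i \<longrightarrow> ev (weight (poly_ext R) i j) z = c * (x i j + x i v * x v j))"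
      if i: "i \<in> vertices R" for i
    proof -
      have i': "i \<in> vertices G - {v}" "i \<in> vertices G" using i VR by auto
      show ?thesis
        unfolding R_def x_def
        by (rule reduced_row[OF assms(1,3) i'(1) d0[OF i'(2)] d0[OF assms(3)]]) blast
    qed
    then obtain c where c: "\<And>i. i \<in> vertices R \<Longrightarrow> c i \<noteq> 0"
      and d_R: "\<And>i. i \<in> vertices R \<Longrightarrow> ?d R i = c i * (1 - x i v * x v i)"
      and w_R: "\<And>i j. i \<in> vertices R \<Longrightarrow> j \<in> vertices R \<Longrightarrow> j \<noteq> i \<Longrightarrow>
        ev (weight (poly_ext R) i j) z = c i * (x i j + x i v * x v j)"
      by metis
    have d_R': "cmod (?d R i) = cmod (c i) * diag' i" if "i \<in> vertices R" for i
      using that by (simp add: d_R diag'_def norm_mult)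
    have r_R: "?r R i = cmod (c i) * \<rho>' i" if "i \<in> vertices R" for i
    proof -
      have "?r R i = (\<Sum>j\<in>{j \<in> vertices R. j \<noteq> i \<and> mutual (edges R) i j}.
          cmod (c i) * cmod (x i j + x i v * x v j))"
        unfolding r_tilde_poly_ext[OF R that] using w_R[OF that]
        by (intro sum.cong) (auto simp: norm_mult)
      then show ?thesis by (simp add: \<rho>'_def VR sum_distrib_left)
    qed
    obtain \<gamma> where \<gamma>: "\<gamma> \<in> cycles R"
      and ge: "(\<Prod>i\<in>cyc_verts \<gamma>. cmod (?d R i)) \<le> (\<Prod>i\<in>cyc_verts \<gamma>. ?r R i)"
      using zR cycles_poly_ext[OF R] by (auto simp: BW_B_def R_def)
    have V: "cyc_verts \<gamma> \<subseteq> vertices R" using finite_cyc_verts[OF \<gamma>] by simp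
    have "(\<Prod>i\<in>cyc_verts \<gamma>. \<rho>' i) < (\<Prod>i\<in>cyc_verts \<gamma>. diag' i)"
    proof (cases "\<gamma> \<in> strong_cycles R")
      case True
      then show ?thesis using reduced_cycle by (auto simp: strong_cycles_eq[OF R])
    next
      case False
      then have "\<gamma> \<in> weak_cycles R" using \<gamma> by (simp add: cycles_def)
      then obtain i where i: "\<gamma> = cyc_of [i]" "i \<in> vertices R"
        and weak: "\<And>\<gamma>. \<gamma> \<in> strong_cycles R \<Longrightarrow> i \<notin> cyc_verts \<gamma>"
        by (auto simp: weak_cycles_def)
      \<comment> \<open>A second vertex in its component would put \<open>i\<close> on a strong
        cycle, so the reduced row sum is empty.\<close>
      have "\<not> mutual (edges R) i j" if ji: "j \<noteq> i" for j
      proof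
        assume "mutual (edges R) i j"
        then obtain us where "cycle_list (edges R) us" "i \<in> set us"
          using ji by (metis mutual_cycle_list)
        then show False using weak[of "cyc_of us"] by (auto simp: strong_cycles_eq[OF R])
      qed
      then have "\<rho>' i = 0" unfolding \<rho>'_def by (intro sum.neutral) auto
      then show ?thesis using diag'_pos[of i] i VR by simp
    qed
    moreover have "(\<Prod>i\<in>cyc_verts \<gamma>. cmod (?d R i)) =
        (\<Prod>i\<in>cyc_verts \<gamma>. cmod (c i)) * (\<Prod>i\<in>cyc_verts \<gamma>. diag' i)"
      unfolding prod.distrib[symmetric] using V d_R' by (intro prod.cong) auto
    moreover have "(\<Prod>i\<in>cyc_verts \<gamma>. ?r R i) =
        (\<Prod>i\<in>cyc_verts \<gamma>. cmod (c i)) * (\<Prod>i\<in>cyc_verts \<gamma>. \<rho>' i)"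
      unfolding prod.distrib[symmetric] using V r_R by (intro prod.cong) auto
    \<comment> \<open>The row factors occur on both sides of \<open>ge\<close>; being positive,
      their product cancels and contradicts the strict inequality.\<close>
    moreover have "0 < (\<Prod>i\<in>cyc_verts \<gamma>. cmod (c i))" using V c by (intro prod_pos) auto
    ultimately show False using ge by simp
  qed
qed

end
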